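(* Let $U^*_c$ be any solution of the optimization problem $$\text{(P.2)}\qquad \max_{U^a}\ \sum_{k=1}^T\overline x(k)^{\mathsf T}\overline x(k)\quad\text{subject to}\quad (U^a)^{\mathsf T}M_cU^a\le\widetilde\delta_c,\qquad \overline x(k+1)=A\overline x(k)+B^au^a(k).$$ Then there exists $\gamma_c>0$ such that the pair $(U^*_c,\gamma_c)$ solves the optimality equations $$\left[\mathcal B_a^{\mathsf T}\mathcal B_a-\gamma_cM_c\right]U^*_c+\mathcal B_a^{\mathsf T}\mathcal A\,x(0)=0,\qquad (U^*_c)^{\mathsf T}M_cU^*_c=\widetilde\delta_c,$$ where $$\mathcal A=\begin{bmatrix}A\\ \vdots\\ A^T\end{bmatrix},\qquad \mathcal B_a=\begin{bmatrix}B^a&\cdots&0\\ \vdots&\ddots&\vdots\\ A^{T-1}B^a&\cdots&B^a\end{bmatrix}.$$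
   Context: System: $x(k+1)=Ax(k)+B^au^a(k)+w(k)$, $y(k)=Cx(k)+v(k)$, with independent (over time and of each other) Gaussian noises $w(k)\sim\mathcal N(0,\Sigma_w)$, $v(k)\sim\mathcal N(0,\Sigma_v)$, deterministic initial state $x(0)$ and deterministic attack $u^a$. It is the stacked form of $N$ interconnected subsystems: $A=[A_{ij}]_{i,j=1}^N$, and $B^a$, $C$, $\Sigma_w$, $\Sigma_v$ are block diagonal with $N$ blocks. Fix a horizon $T>0$ and let $U^a=[u^a(0)^{\mathsf T}\cdots u^a(T-1)^{\mathsf T}]^{\mathsf T}$. In (P.2), $\overline x(k)=\mathbb E[x(k)]$, so $\overline x(0)=x(0)$. Define $\mathcal O_c=[(CA)^{\mathsf T}\cdots(CA^T)^{\mathsf T}]^{\mathsf T}$, and let $\mathcal F^{(a)}_c$, $\mathcal F^{(w)}_c$ be the $T\times T$ block matrices whose $(j,l)$ block is $CA^{j-l}B^a$, resp. $CA^{j-l}$, for $j\ge l$ and $0$ for $j<l$. Let the rows of $N_c$ form a basis of the left null space of $\mathcal O_c$, assumed nontrivial. Let $\Sigma_c=N_c[\mathcal F^{(w)}_c(I_T\otimes\Sigma_w)(\mathcal F^{(w)}_c)^{\mathsf T}+(I_T\otimes\Sigma_v)]N_c^{\mathsf T}$, assumed invertible, and $M_c=(N_c\mathcal F^{(a)}_c)^{\mathsf T}\Sigma_c^{-1}(N_c\mathcal F^{(a)}_c)$, $p_c=\mathrm{Rank}(\Sigma_c)$. Let $Q(\tau;p,\lambda)$ be the complementary cumulative distribution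 function at $\tau$ of the noncentral chi-squared distribution with $p$ degrees of freedom and noncentrality parameter $\lambda$. The threshold $\tau_c\ge0$ is fixed by the given false alarm probability $P^F_c=Q(\tau_c;p_c,0)$. For a detectability tolerance $P^F_c\le\delta_c\le1$, $\widetilde\delta_c=Q^{-1}_{p_c,\tau_c}(\delta_c)\in[0,\infty]$, where $Q^{-1}_{p_c,\tau_c}$ is the inverse of the (increasing) function $\lambda\mapsto Q(\tau_c;p_c,\lambda)$ for fixed $p_c,\tau_c$.
   Formalization: Two hypotheses are added: B^a ≠ 0 (otherwise M_c = 0 and the constraint need not be active), and P^F_c < δ_c instead of P^F_c ≤ δ_c (at equality the bound is 0 and the first equation can fail, e.g. when U* = 0 is the only feasible point). *)

theory Defs
  imports "HOL-Probability.Probability"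
begin

section \<open>Time indices and stacked matrices\<close>

text \<open>
  The horizon \<open>T\<close> is the cardinality of a finite linearly ordered index type \<open>'t\<close>, whose
  elements stand for the times \<open>0, \<dots>, T - 1\<close> in increasing order.  A vector stacking \<open>T\<close> blocks
  of type \<open>real ^ 'm\<close> has type \<open>real ^ ('t \<times> 'm)\<close>.
\<close>

definition time_pos :: "'t::{finite,linorder} \<Rightarrow> nat"
  where "time_pos t = card {s. s < t}"

definition block_at :: "real ^ ('t::{finite,linorder} \<times> 'm::finite) \<Rightarrow> nat \<Rightarrow> real ^ 'm"
  where "block_at U k = (\<chi> i. U $ (inv time_pos k, i))"

text \<open>The power operation of the type class is entrywise on matrices.\<close>

primrec matpow :: "real ^ 'n ^ 'n \<Rightarrow> nat \<Rightarrow> real ^ 'n ^ 'n"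
  where
    "matpow A 0 = mat 1"
  | "matpow A (Suc k) = A ** matpow A k"

text \<open>The block column \<open>[C A; \<dots>; C A^T]\<close>; the block at time index \<open>t\<close> is \<open>C A^(t+1)\<close>.\<close>

definition obs_col ::
    "real ^ 'n ^ 'p \<Rightarrow> real ^ 'n ^ 'n \<Rightarrow> real ^ 'n ^ ('t::{finite,linorder} \<times> 'p::finite)"
  where "obs_col C A = (\<chi> r. (C ** matpow A (Suc (time_pos (fst r)))) $ snd r)"

text \<open>The lower triangular block Toeplitz matrix with blocks \<open>C A^(j-l) G\<close> for \<open>j \<ge> l\<close>.\<close>

definition toeplitz ::
    "real ^ 'n ^ 'p \<Rightarrow> real ^ 'n ^ 'n \<Rightarrow> real ^ 'm ^ 'n
      \<Rightarrow> real ^ ('t \<times> 'm::finite) ^ ('t::{finite,linorder} \<times> 'p::finite)"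
  where "toeplitz C A G = (\<chi> r c.
    if fst c \<le> fst r
    then (C ** matpow A (time_pos (fst r) - time_pos (fst c)) ** G) $ snd r $ snd c
    else 0)"

definition kron ::
    "real ^ 'a ^ 'b \<Rightarrow> real ^ 'c ^ 'd
      \<Rightarrow> real ^ ('a::finite \<times> 'c::finite) ^ ('b::finite \<times> 'd::finite)"
  where "kron K S = (\<chi> r c. K $ fst r $ fst c * S $ snd r $ snd c)"

text \<open>
  A partition of a coordinate set into the coordinates of the subsystems is given by a map to
  the index type \<open>'s\<close> of subsystems.
\<close>

definition block_diagonal :: "('r \<Rightarrow> 's) \<Rightarrow> ('c \<Rightarrow> 's) \<Rightarrow> real ^ 'c ^ 'r \<Rightarrow> bool"
  where "block_diagonal f g M \<longleftrightarrow> (\<forall>i j. f i \<noteq> g j \<longrightarrow> M $ i $ j = 0)"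


section \<open>Noise and state process\<close>

definition covariance_matrix :: "real ^ 'n ^ 'n \<Rightarrow> bool"
  where "covariance_matrix S \<longleftrightarrow> transpose S = S \<and> (\<forall>a. 0 \<le> a \<bullet> (S *v a))"

text \<open>
  A Gaussian vector with mean zero and possibly singular covariance matrix: every linear
  functional of it is a, possibly degenerate, centred Gaussian random variable.
\<close>

definition centred_gaussian :: "'w measure \<Rightarrow> ('w \<Rightarrow> real ^ 'n) \<Rightarrow> real ^ 'n ^ 'n \<Rightarrow> bool"
  where "centred_gaussian P X S \<longleftrightarrow>
    X \<in> borel_measurable P \<and> covariance_matrix S \<and>
    (\<forall>a. distr P borel (\<lambda>\<omega>. a \<bullet> X \<omega>) =
      (if a \<bullet> (S *v a) = 0 then return borel 0
       else density lborel (\<lambda>z. ennreal (normal_density 0 (sqrt (a \<bullet> (S *v a))) z))))"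

definition noise_model ::
    "'w measure \<Rightarrow> (nat \<Rightarrow> 'w \<Rightarrow> real ^ 'n) \<Rightarrow> (nat \<Rightarrow> 'w \<Rightarrow> real ^ 'p)
      \<Rightarrow> real ^ 'n ^ 'n \<Rightarrow> real ^ 'p ^ 'p \<Rightarrow> bool"
  where "noise_model P w v Sw Sv \<longleftrightarrow>
    prob_space P \<and>
    (\<forall>k. centred_gaussian P (w k) Sw) \<and>
    (\<forall>k. centred_gaussian P (v k) Sv) \<and>
    prob_space.indep_sets P
      (\<lambda>s. case s of Inl k \<Rightarrow> sets (vimage_algebra (space P) (w k) borel)
                   | Inr k \<Rightarrow> sets (vimage_algebra (space P) (v k) borel))
      (UNIV :: (nat + nat) set)"

primrec state ::
    "real ^ 'n ^ 'n \<Rightarrow> real ^ 'm ^ 'n \<Rightarrow> (nat \<Rightarrow> 'w \<Rightarrow> real ^ 'n) \<Rightarrow> real ^ 'n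
      \<Rightarrow> (nat \<Rightarrow> real ^ 'm) \<Rightarrow> nat \<Rightarrow> 'w \<Rightarrow> real ^ 'n"
  where
    "state A B w x0 u 0 = (\<lambda>\<omega>. x0)"
  | "state A B w x0 u (Suc k) = (\<lambda>\<omega>. A *v state A B w x0 u k \<omega> + B *v u k + w k \<omega>)"

definition mean_state ::
    "'w measure \<Rightarrow> real ^ 'n ^ 'n \<Rightarrow> real ^ 'm ^ 'n \<Rightarrow> (nat \<Rightarrow> 'w \<Rightarrow> real ^ 'n) \<Rightarrow> real ^ 'n
      \<Rightarrow> (nat \<Rightarrow> real ^ 'm) \<Rightarrow> nat \<Rightarrow> real ^ 'n"
  where "mean_state P A B w x0 u k = (\<integral>\<omega>. state A B w x0 u k \<omega> \<partial>P)"


section \<open>Detector\<close>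

definition left_null_basis :: "real ^ 'k ^ 'r \<Rightarrow> real ^ 'n ^ 'k \<Rightarrow> bool"
  where "left_null_basis N M \<longleftrightarrow>
    inj (\<lambda>i. row i N) \<and> independent (rows N) \<and> span (rows N) = {z. z v* M = 0}"

definition detector_cov ::
    "real ^ ('t::{finite,linorder} \<times> 'p::finite) ^ 'r \<Rightarrow> real ^ 'n ^ 'p \<Rightarrow> real ^ 'n ^ 'n
      \<Rightarrow> real ^ 'n ^ 'n \<Rightarrow> real ^ 'p ^ 'p \<Rightarrow> real ^ 'r ^ 'r"
  where "detector_cov N C A Sw Sv =
    (let F = toeplitz C A (mat 1)
     in N ** (F ** kron (mat 1) Sw ** transpose F + kron (mat 1) Sv) ** transpose N)"

definition detector_gain ::
    "real ^ ('t \<times> 'p) ^ 'r \<Rightarrow> real ^ 'n ^ 'p \<Rightarrow> real ^ 'n ^ 'n \<Rightarrow> real ^ 'm ^ 'n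
      \<Rightarrow> real ^ 'n ^ 'n \<Rightarrow> real ^ 'p ^ 'p
      \<Rightarrow> real ^ ('t \<times> 'm) ^ ('t::{finite,linorder} \<times> 'm::finite)"
  where "detector_gain N C A B Sw Sv =
    (let G = N ** toeplitz C A B
     in transpose G ** matrix_inv (detector_cov N C A Sw Sv) ** G)"

text \<open>
  The law of \<open>(Z_0 + \<mu>_0)^2 + \<dots> + (Z_(p-1) + \<mu>_(p-1))^2\<close> for independent standard Gaussian \<open>Z_i\<close>
  depends on \<open>\<mu>\<close> only through \<open>l = \<mu>_0^2 + \<dots> + \<mu>_(p-1)^2\<close>; the representative
  \<open>\<mu> = (sqrt l, 0, \<dots>, 0)\<close> is used.  Meaningful for \<open>p \<ge> 1\<close> and \<open>l \<ge> 0\<close>.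
\<close>

definition noncentral_chi_squared :: "nat \<Rightarrow> real \<Rightarrow> real measure"
  where "noncentral_chi_squared p l =
    distr
      (\<Pi>\<^sub>M i\<in>{..<p}.
        density lborel (\<lambda>z. ennreal (normal_density (if i = 0 then sqrt l else 0) 1 z)))
      borel (\<lambda>z. \<Sum>i<p. (z i)\<^sup>2)"

text \<open>The value 1 at infinite noncentrality is the limit as \<open>l\<close> tends to infinity.\<close>

definition chi_ccdf :: "real \<Rightarrow> nat \<Rightarrow> ereal \<Rightarrow> real"
  where "chi_ccdf \<tau> p l =
    (if l = \<infinity> then 1 else measure (noncentral_chi_squared p (real_of_ereal l)) {\<tau><..})"

definition chi_ccdf_inv :: "real \<Rightarrow> nat \<Rightarrow> real \<Rightarrow> ereal"
  where "chi_ccdf_inv \<tau> p = inv_into {0..} (chi_ccdf \<tau> p)"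


section \<open>The attacker's optimization problem\<close>

text \<open>The mean dynamics hold automatically for the expectation of the state process.\<close>

definition attack_feasible ::
    "'w measure \<Rightarrow> real ^ 'n ^ 'n \<Rightarrow> real ^ 'm ^ 'n \<Rightarrow> (nat \<Rightarrow> 'w \<Rightarrow> real ^ 'n) \<Rightarrow> real ^ 'n
      \<Rightarrow> real ^ ('t \<times> 'm) ^ ('t \<times> 'm) \<Rightarrow> ereal
      \<Rightarrow> real ^ ('t::{finite,linorder} \<times> 'm::finite) \<Rightarrow> bool"
  where "attack_feasible P A B w x0 M d U \<longleftrightarrow>
    ereal (U \<bullet> (M *v U)) \<le> d \<and>
    (\<forall>k<CARD('t). mean_state P A B w x0 (block_at U) (Suc k) =
      A *v mean_state P A B w x0 (block_at U) k + B *v block_at U k)"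

definition attack_objective ::
    "'w measure \<Rightarrow> real ^ 'n ^ 'n \<Rightarrow> real ^ 'm ^ 'n \<Rightarrow> (nat \<Rightarrow> 'w \<Rightarrow> real ^ 'n) \<Rightarrow> real ^ 'n
      \<Rightarrow> real ^ ('t::{finite,linorder} \<times> 'm::finite) \<Rightarrow> real"
  where "attack_objective P A B w x0 U =
    (\<Sum>k=1..CARD('t).
      mean_state P A B w x0 (block_at U) k \<bullet> mean_state P A B w x0 (block_at U) k)"

definition attack_solution ::
    "'w measure \<Rightarrow> real ^ 'n ^ 'n \<Rightarrow> real ^ 'm ^ 'n \<Rightarrow> (nat \<Rightarrow> 'w \<Rightarrow> real ^ 'n) \<Rightarrow> real ^ 'n
      \<Rightarrow> real ^ ('t \<times> 'm) ^ ('t \<times> 'm) \<Rightarrow> ereal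
      \<Rightarrow> real ^ ('t::{finite,linorder} \<times> 'm::finite) \<Rightarrow> bool"
  where "attack_solution P A B w x0 M d =
    is_arg_max (attack_objective P A B w x0) (attack_feasible P A B w x0 M d)"

end

theory Submission
  imports Defs "HOL-Real_Asymp.Real_Asymp"
begin

text \<open>
  The noises are centred, so the mean trajectory is the stacked vector \<open>\<A> x(0) + \<B> U\<close>
  (lemma \<open>attack_objective_eq\<close>), and the attacker maximizes \<open>\<bar>\<A> x(0) + \<B> U\<bar>\<^sup>2\<close>
  subject to \<open>U \<bullet> M U \<le> d\<close> with \<open>M\<close> symmetric.  As \<open>B \<noteq> 0\<close>, also \<open>\<B> \<noteq> 0\<close>, and a convex
  quadratic \<open>\<bar>a + \<B> U\<bar>\<^sup>2\<close> that is not constant has no local maximum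
  (lemma \<open>not_directional_max\<close>).  Hence a solution can exist only for a finite bound \<open>d\<close> and
  must use it up entirely.

  If moreover \<open>d > 0\<close>, then \<open>M U \<noteq> 0\<close>: the constraint is regular at \<open>U\<close>, a multiplier exists, and it is
  positive, because a vanishing multiplier would make \<open>U\<close> a stationary point of a convex function,
  that is, a minimum (lemma \<open>constrained_max_multiplier\<close>).  The optimality equation is the resulting stationarity
  condition.

  That \<open>d > 0\<close> is where the detector enters.  The bound is the noncentrality at which the
  chi-squared detection probability reaches \<open>\<delta>\<close>, and at noncentrality 0 this probability is the
  false alarm probability, which is below \<open>\<delta>\<close>.  It remains to know that \<open>\<delta>\<close> is attained at all,
  that is, that the detection probability depends continuously on the noncentrality and tends to 1
  (lemma \<open>noncentral_chi_squared_ccdf_continuous_limit\<close>).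
\<close>

section \<open>Maximizing a convex quadratic under a quadratic constraint\<close>

lemma norm_sq_along_ray:
  fixes H :: "real ^ 'u ^ 'x"
  shows "(a + H *v (U + t *\<^sub>R h)) \<bullet> (a + H *v (U + t *\<^sub>R h))
    = (a + H *v U) \<bullet> (a + H *v U)
      + t * (2 * ((transpose H *v (a + H *v U)) \<bullet> h) + t * ((H *v h) \<bullet> (H *v h)))"
proof -
  have "(transpose H *v y) \<bullet> h = y \<bullet> (H *v h)" for y
    by (simp add: dot_lmul_matrix)
  moreover have "a + H *v (U + t *\<^sub>R h) = (a + H *v U) + t *\<^sub>R (H *v h)"
    by (simp add: matrix_vector_right_distrib matrix_vector_mult_scaleR)
  ultimately show ?thesis
    by (simp add: inner_add_left inner_add_right inner_commute algebra_simps)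
qed

text \<open>
  Convexity: moving to \<open>U + t h\<close> and to \<open>U - t' h\<close> changes the first-order term with opposite
  signs, while the second-order term \<open>\<bar>H h\<bar>\<^sup>2\<close> is nonnegative both times.  A step length may depend on
  the direction, so the lemma serves for interior points of the feasible set as well as for an
  unconstrained problem.
\<close>

lemma not_directional_max:
  fixes H :: "real ^ 'u ^ 'x"
  assumes "\<And>h. \<exists>t>0. (a + H *v (U + t *\<^sub>R h)) \<bullet> (a + H *v (U + t *\<^sub>R h))
      \<le> (a + H *v U) \<bullet> (a + H *v U)"
  shows "H = 0"
proof -
  have le: "2 * ((transpose H *v (a + H *v U)) \<bullet> h) \<le> - (t * ((H *v h) \<bullet> (H *v h)))"
    if "t > 0" "(a + H *v (U + t *\<^sub>R h)) \<bullet> (a + H *v (U + t *\<^sub>R h))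
      \<le> (a + H *v U) \<bullet> (a + H *v U)" for t h
    using that by (simp add: norm_sq_along_ray mult_le_0_iff)
  have "H *v h = 0" for h
  proof -
    obtain s t where st: "s > 0" "t > 0"
      "2 * ((transpose H *v (a + H *v U)) \<bullet> h) \<le> - (s * ((H *v h) \<bullet> (H *v h)))"
      "2 * ((transpose H *v (a + H *v U)) \<bullet> (- h)) \<le> - (t * ((H *v (- h)) \<bullet> (H *v (- h))))"
      using assms[of h] assms[of "- h"] le by blast
    have "H *v (- h) = - (H *v h)"
      by (metis matrix_vector_mult_scaleR scaleR_minus1_left)
    with st have "(s + t) * ((H *v h) \<bullet> (H *v h)) \<le> 0"
      by (simp add: distrib_right)
    with st have "(H *v h) \<bullet> (H *v h) \<le> 0"
      by (simp add: mult_le_0_iff)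
    then show ?thesis by (metis inner_eq_zero_iff inner_ge_zero order_antisym)
  qed
  then show ?thesis by (simp add: matrix_eq)
qed

lemma quadratic_along_ray:
  fixes M :: "real ^ 'u ^ 'u"
  assumes "transpose M = M"
  shows "(U + t *\<^sub>R h) \<bullet> (M *v (U + t *\<^sub>R h))
    = U \<bullet> (M *v U) + t * (2 * (h \<bullet> (M *v U)) + t * (h \<bullet> (M *v h)))"
proof -
  have "U \<bullet> (M *v h) = h \<bullet> (M *v U)"
    by (metis assms dot_lmul_matrix inner_commute vector_transpose_matrix)
  then show ?thesis
    by (simp add: matrix_vector_right_distrib matrix_vector_mult_scaleR inner_add_left
        inner_add_right algebra_simps)
qed

lemma small_step:
  fixes b c s :: real
  assumes "s > 0"
  obtains t where "t > 0" "t * (b + t * c) \<le> s"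
proof
  define t where "t = min 1 (s / (\<bar>b\<bar> + \<bar>c\<bar> + 1))"
  show t: "t > 0" using assms by (simp add: t_def)
  have "t * c \<le> \<bar>c\<bar>"
    using t by (smt (verit) mult_left_le_one_le t_def min.cobounded1 abs_ge_self mult_left_mono abs_ge_zero)
  then have "t * (b + t * c) \<le> t * (\<bar>b\<bar> + \<bar>c\<bar> + 1)"
    using t by (intro mult_left_mono) auto
  also have "\<dots> \<le> s / (\<bar>b\<bar> + \<bar>c\<bar> + 1) * (\<bar>b\<bar> + \<bar>c\<bar> + 1)"
    by (intro mult_right_mono) (auto simp: t_def)
  finally show "t * (b + t * c) \<le> s" by (simp add: add_nonneg_pos add.assoc)
qed

text \<open>
  At an active constraint, every direction \<open>h\<close> with \<open>h \<bullet> M U < 0\<close> stays feasible for a short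
  time, hence has nonpositive inner product with the (halved) objective gradient \<open>g\<close>.  As \<open>M U \<noteq> 0\<close>,
  this half-space condition alone makes \<open>g\<close> a nonnegative multiple of \<open>M U\<close>.  The multiplier
  cannot vanish: with \<open>g = 0\<close> the objective grows by \<open>t\<^sup>2 \<bar>H h\<bar>\<^sup>2\<close> along each such \<open>h\<close>, so \<open>H\<close>
  would vanish on an open half-space and hence everywhere.
\<close>

lemma constrained_max_multiplier:
  fixes H :: "real ^ 'u ^ 'x" and M :: "real ^ 'u ^ 'u"
  assumes sym: "transpose M = M" and "H \<noteq> 0" and "d > 0"
    and feas: "U \<bullet> (M *v U) \<le> d"
    and opt: "\<And>V. V \<bullet> (M *v V) \<le> d \<Longrightarrow>
      (a + H *v V) \<bullet> (a + H *v V) \<le> (a + H *v U) \<bullet> (a + H *v U)"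
  shows "U \<bullet> (M *v U) = d"
    and "\<exists>\<gamma>>0. transpose H *v (a + H *v U) = \<gamma> *\<^sub>R (M *v U)"
proof -
  show active: "U \<bullet> (M *v U) = d"
  proof (rule ccontr)
    assume "U \<bullet> (M *v U) \<noteq> d"
    with feas have slack: "d - U \<bullet> (M *v U) > 0" by simp
    have "H = 0"
    proof (rule not_directional_max)
      fix h
      obtain t where "t > 0"
        "t * (2 * (h \<bullet> (M *v U)) + t * (h \<bullet> (M *v h))) \<le> d - U \<bullet> (M *v U)"
        using small_step[OF slack] by metis
      then show "\<exists>t>0. (a + H *v (U + t *\<^sub>R h)) \<bullet> (a + H *v (U + t *\<^sub>R h))
          \<le> (a + H *v U) \<bullet> (a + H *v U)"
        by (intro exI[of _ t] conjI opt) (simp_all add: quadratic_along_ray[OF sym])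
    qed
    with \<open>H \<noteq> 0\<close> show False by simp
  qed
  define m where "m = M *v U"
  define g where "g = transpose H *v (a + H *v U)"
  have "m \<noteq> 0" using active \<open>d > 0\<close> by (auto simp: m_def)
  then have mm: "m \<bullet> m > 0" by simp
  have dir: "g \<bullet> h \<le> 0 \<and> (g \<bullet> h = 0 \<longrightarrow> H *v h = 0)" if h: "h \<bullet> m < 0" for h
  proof -
    define t where "t = - (h \<bullet> m) / (\<bar>h \<bullet> (M *v h)\<bar> + 1)"
    have t: "t > 0" using h by (simp add: t_def divide_neg_pos add_nonneg_pos)
    have "t * (h \<bullet> (M *v h)) \<le> t * (\<bar>h \<bullet> (M *v h)\<bar> + 1)"
      using t by (intro mult_left_mono) auto
    also have "\<dots> = - (h \<bullet> m)"
      unfolding t_def by (simp add: add_nonneg_pos less_imp_neq[symmetric])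
    finally have "2 * (h \<bullet> m) + t * (h \<bullet> (M *v h)) \<le> 0" using h by simp
    then have "(U + t *\<^sub>R h) \<bullet> (M *v (U + t *\<^sub>R h)) \<le> d"
      using t active by (simp add: quadratic_along_ray[OF sym] m_def mult_le_0_iff)
    from opt[OF this] have "2 * (g \<bullet> h) + t * ((H *v h) \<bullet> (H *v h)) \<le> 0"
      using t by (simp add: norm_sq_along_ray g_def mult_le_0_iff)
    moreover have "t * ((H *v h) \<bullet> (H *v h)) \<ge> 0" using t by simp
    moreover have "t * ((H *v h) \<bullet> (H *v h)) = 0 \<Longrightarrow> H *v h = 0" using t by simp
    ultimately show ?thesis by (smt (verit))
  qed
  \<comment> \<open>The component of \<open>g\<close> orthogonal to \<open>m\<close> lies on the boundary of the half-space only, so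
    \<open>dir\<close> is applied to it after a small tilt towards \<open>- m\<close>.\<close>
  define c where "c = (g \<bullet> m) / (m \<bullet> m)"
  define r where "r = g - c *\<^sub>R m"
  have rm: "r \<bullet> m = 0" using mm by (simp add: r_def c_def inner_diff_left)
  have "r \<bullet> r \<le> e" if e: "e > 0" for e :: real
  proof -
    define s where "s = e / (\<bar>g \<bullet> m\<bar> + 1)"
    have s: "s > 0" using e by (simp add: s_def)
    have "(r - s *\<^sub>R m) \<bullet> m < 0"
      using mm s rm by (simp add: inner_diff_left)
    from dir[OF this] have "g \<bullet> r \<le> s * (g \<bullet> m)" by (simp add: inner_diff_right)
    moreover have "g \<bullet> r = r \<bullet> r"
      using rm by (simp add: r_def inner_diff_left inner_diff_right inner_commute algebra_simps)
    moreover have "s * (g \<bullet> m) \<le> s * (\<bar>g \<bullet> m\<bar> + 1)"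
      using s by (intro mult_left_mono) auto
    moreover have "s * (\<bar>g \<bullet> m\<bar> + 1) = e"
      unfolding s_def by (simp add: add_nonneg_pos less_imp_neq[symmetric])
    ultimately show ?thesis by linarith
  qed
  then have "r \<bullet> r \<le> 0" by (meson dense_ge)
  then have "r = 0" by (metis inner_eq_zero_iff inner_ge_zero order_antisym)
  then have g: "g = c *\<^sub>R m" by (simp add: r_def)
  have "(- m) \<bullet> m < 0" using mm by simp
  from dir[OF this] g mm have "c \<ge> 0" by (simp add: zero_le_mult_iff)
  moreover have "c \<noteq> 0"
  proof
    assume "c = 0"
    then have van: "H *v h = 0" if "h \<bullet> m < 0" for h using dir[OF that] g by simp
    have "H *v h = 0" for h
    proof -
      define k where "k = (\<bar>h \<bullet> m\<bar> + 1) / (m \<bullet> m)"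
      have "(h - k *\<^sub>R m) \<bullet> m < 0" "(- k *\<^sub>R m) \<bullet> m < 0"
        using mm by (simp_all add: k_def inner_diff_left add_nonneg_pos)
      then have "H *v (h - k *\<^sub>R m) = 0" "H *v (- k *\<^sub>R m) = 0" using van by blast+
      then show ?thesis
        by (metis (no_types) add_uminus_conv_diff matrix_vector_mult_diff_distrib
            diff_0_right scaleR_minus_left add.right_neutral matrix_vector_right_distrib)
    qed
    with \<open>H \<noteq> 0\<close> show False by (simp add: matrix_eq)
  qed
  ultimately show "\<exists>\<gamma>>0. transpose H *v (a + H *v U) = \<gamma> *\<^sub>R (M *v U)"
    using g unfolding g_def m_def by (intro exI[of _ c]) simp
qed


section \<open>The mean trajectory as a function of the stacked attack\<close>

text \<open>
  The definition speaks about linear functionals only, so both claims are read off coordinatewise.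
\<close>

lemma centred_gaussian_mean:
  fixes X :: "'w \<Rightarrow> real ^ 'n"
  assumes "centred_gaussian P X S"
  shows "integrable P X" "(\<integral>\<omega>. X \<omega> \<partial>P) = 0"
proof -
  have X: "X \<in> borel_measurable P" using assms by (simp add: centred_gaussian_def)
  have lin: "integrable P (\<lambda>\<omega>. X \<omega> \<bullet> a) \<and> (\<integral>\<omega>. X \<omega> \<bullet> a \<partial>P) = 0" for a
  proof -
    let ?D = "distr P borel (\<lambda>\<omega>. a \<bullet> X \<omega>)"
    have D: "?D = (if a \<bullet> (S *v a) = 0 then return borel 0
       else density lborel (\<lambda>z. ennreal (normal_density 0 (sqrt (a \<bullet> (S *v a))) z)))"
      and nonneg: "a \<bullet> (S *v a) \<ge> 0"
      using assms by (simp_all add: centred_gaussian_def covariance_matrix_def)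
    have "integrable ?D (\<lambda>z. z) \<and> (\<integral>z. z \<partial>?D) = 0"
    proof (cases "a \<bullet> (S *v a) = 0")
      case True
      then have D0: "?D = return borel 0" unfolding D by (rule if_P)
      have "integrable (return borel 0) (\<lambda>z::real. z)"
        by (rule integrableI_bounded) (simp_all add: nn_integral_return)
      moreover have "(\<integral>z. z \<partial>return borel (0::real)) = 0"
        by (rule integral_return) simp_all
      ultimately show ?thesis unfolding D0 ..
    next
      case False
      define \<sigma> where "\<sigma> = sqrt (a \<bullet> (S *v a))"
      have \<sigma>: "\<sigma> > 0" using nonneg False by (simp add: \<sigma>_def)
      have D0: "?D = density lborel (\<lambda>z. ennreal (normal_density 0 \<sigma> z))"
        unfolding D \<sigma>_def using False by (rule if_not_P)
      show ?thesis
        unfolding D0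
        using integrable_normal_moment_nz_1[OF \<sigma>, of 0] integral_normal_moment_nz_1[OF \<sigma>, of 0]
        by (simp add: integrable_density integral_density)
    qed
    then show ?thesis
      using X by (simp add: integrable_distr_eq integral_distr inner_commute)
  qed
  have "integrable P (\<lambda>\<omega>. \<Sum>b\<in>Basis. (X \<omega> \<bullet> b) *\<^sub>R b)"
    using lin by (intro Bochner_Integration.integrable_sum integrable_scaleR_left) blast
  then show i: "integrable P X" by (simp add: euclidean_representation)
  show "(\<integral>\<omega>. X \<omega> \<partial>P) = 0"
  proof (rule euclidean_eqI)
    fix b :: "real ^ 'n"
    have "(\<integral>\<omega>. X \<omega> \<partial>P) \<bullet> b = (\<integral>\<omega>. X \<omega> \<bullet> b \<partial>P)"
      using i by (intro integral_inner_left[symmetric])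
    then show "(\<integral>\<omega>. X \<omega> \<partial>P) \<bullet> b = 0 \<bullet> b" using lin[of b] by (simp only: inner_zero_left)
  qed
qed

lemma mean_state_dynamics:
  fixes w :: "nat \<Rightarrow> 'w \<Rightarrow> real ^ 'n"
  assumes "prob_space P" and "\<And>k. centred_gaussian P (w k) S"
  shows "mean_state P A B w x0 u 0 = x0"
    and "mean_state P A B w x0 u (Suc k) = A *v mean_state P A B w x0 u k + B *v u k"
proof -
  interpret prob_space P by fact
  show "mean_state P A B w x0 u 0 = x0" by (simp add: mean_state_def prob_space)
  note w = centred_gaussian_mean[OF assms(2)]
  have lin: "bounded_linear ((*v) A)" by (simp add: matrix_vector_mul_bounded_linear)
  have int: "integrable P (state A B w x0 u k)" for k
    by (induction k) (auto intro!: Bochner_Integration.integrable_add w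
        integrable_bounded_linear[OF lin])
  show "mean_state P A B w x0 u (Suc k) = A *v mean_state P A B w x0 u k + B *v u k"
    using w int[of k] integrable_bounded_linear[OF lin int[of k]]
      integral_bounded_linear[OF lin int[of k]]
    by (simp add: mean_state_def prob_space)
qed

lemma linear_recurrence_solution:
  fixes x :: "nat \<Rightarrow> real ^ 'n"
  assumes "\<And>k. x (Suc k) = A *v x k + B *v u k"
  shows "x k = matpow A k *v x 0 + (\<Sum>l<k. (matpow A (k - Suc l) ** B) *v u l)"
proof (induction k)
  case (Suc k)
  have "A *v (\<Sum>l<k. (matpow A (k - Suc l) ** B) *v u l)
      = (\<Sum>l<k. (matpow A (Suc k - Suc l) ** B) *v u l)"
    unfolding vec.linear_sum[OF matrix_vector_mul_linear_gen]
    by (intro sum.cong refl)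
      (simp add: matrix_vector_mul_assoc matrix_mul_assoc flip: matpow.simps(2) Suc_diff_Suc)
  then show ?case
    by (simp add: assms Suc matrix_vector_right_distrib matrix_vector_mul_assoc)
qed simp

lemma time_pos_less_iff: "time_pos s < time_pos t \<longleftrightarrow> s < t"
proof -
  have "time_pos s < time_pos t" if "s < t" for s t :: 'a
    unfolding time_pos_def using that by (intro psubset_card_mono) auto
  then show ?thesis by (metis less_asym linorder_neqE order_less_irrefl)
qed

lemma time_pos_le_iff: "time_pos s \<le> time_pos t \<longleftrightarrow> s \<le> t"
  by (simp add: time_pos_less_iff flip: not_less)

lemma inj_time_pos: "inj time_pos"
  by (intro injI) (metis time_pos_le_iff order_antisym order_refl)

lemma range_time_pos: "range (time_pos :: 't::{finite,linorder} \<Rightarrow> nat) = {..<CARD('t)}"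
proof (rule card_subset_eq)
  show "range (time_pos :: 't \<Rightarrow> nat) \<subseteq> {..<CARD('t)}"
    by (auto simp: time_pos_def intro!: psubset_card_mono)
qed (simp_all add: card_image inj_time_pos)

lemma time_pos_image_atMost: "time_pos ` {..t} = {..time_pos t}"
proof -
  have "k \<in> time_pos ` {..t}" if "k \<le> time_pos t" for k
  proof -
    have "time_pos t < CARD('a)" using range_time_pos by blast
    with that have "k \<in> range (time_pos :: 'a \<Rightarrow> nat)" by (simp add: range_time_pos)
    with that show ?thesis by (auto simp: time_pos_le_iff)
  qed
  then show ?thesis by (auto simp: time_pos_le_iff)
qed

lemma block_at_time_pos: "block_at U (time_pos t) $ i = U $ (t, i)"
  by (simp add: block_at_def inv_f_f[OF inj_time_pos])

lemma obs_col_mult_component: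
  "(obs_col C A *v x) $ (t, i) = ((C ** matpow A (Suc (time_pos t))) *v x) $ i"
  by (simp add: obs_col_def matrix_vector_mult_def)

lemma toeplitz_mult_component:
  "(toeplitz C A G *v U) $ (t, i)
    = (\<Sum>l\<le>time_pos t. ((C ** matpow A (time_pos t - l) ** G) *v block_at U l) $ i)"
proof -
  have "(toeplitz C A G *v U) $ (t, i) = (\<Sum>s\<in>UNIV. \<Sum>j\<in>UNIV. toeplitz C A G $ (t, i) $ (s, j) * U $ (s, j))"
    by (simp add: matrix_vector_mult_def sum.cartesian_product flip: UNIV_Times_UNIV)
  also have "\<dots> = (\<Sum>s\<in>UNIV. if s \<le> t then
      ((C ** matpow A (time_pos t - time_pos s) ** G) *v block_at U (time_pos s)) $ i else 0)"
    by (intro sum.cong refl)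
      (simp add: toeplitz_def matrix_vector_mult_def block_at_time_pos)
  also have "\<dots> = (\<Sum>s\<in>{..t}. ((C ** matpow A (time_pos t - time_pos s) ** G) *v block_at U (time_pos s)) $ i)"
    by (simp add: sum.If_cases atMost_def)
  also have "\<dots> = (\<Sum>l\<in>time_pos ` {..t}. ((C ** matpow A (time_pos t - l) ** G) *v block_at U l) $ i)"
    by (simp add: sum.reindex inj_on_subset[OF inj_time_pos])
  finally show ?thesis by (simp add: time_pos_image_atMost)
qed

text \<open>
  The diagonal blocks of the matrix are copies of \<open>B\<close>.
\<close>

lemma toeplitz_nonzero:
  assumes "B \<noteq> 0"
  shows "(toeplitz (mat 1) A B :: real ^ ('t \<times> 'm::finite) ^ ('t::{finite,linorder} \<times> 'p::finite)) \<noteq> 0"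
proof
  assume z: "(toeplitz (mat 1) A B :: real ^ ('t \<times> 'm) ^ ('t \<times> 'p)) = 0"
  have "(toeplitz (mat 1) A B :: real ^ ('t \<times> 'm) ^ ('t \<times> 'p)) $ (t, i) $ (t, j) = B $ i $ j" for t i j
    by (simp add: toeplitz_def)
  with z have "B = 0" by (simp add: vec_eq_iff)
  with assms show False ..
qed

lemma stacked_recurrence:
  fixes U :: "real ^ ('t::{finite,linorder} \<times> 'm::finite)" and x :: "nat \<Rightarrow> real ^ 'n"
  assumes "\<And>k. x (Suc k) = A *v x k + B *v block_at U k"
  shows "(obs_col (mat 1) A *v x 0 + toeplitz (mat 1) A B *v U) $ (t, i) = x (Suc (time_pos t)) $ i"
  using linear_recurrence_solution[of x A B "block_at U" "Suc (time_pos t)", OF assms]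
  by (simp add: obs_col_mult_component toeplitz_mult_component lessThan_Suc_atMost del: matpow.simps)

text \<open>
  The stacked mean trajectory is an affine image of the attack, which turns the attacker's problem
  into the maximization of a convex quadratic.
\<close>

lemma attack_objective_eq:
  fixes U :: "real ^ ('t::{finite,linorder} \<times> 'm::finite)" and w :: "nat \<Rightarrow> 'w \<Rightarrow> real ^ 'n"
  assumes "prob_space P" and "\<And>k. centred_gaussian P (w k) S"
  shows "attack_objective P A B w x0 U
    = (obs_col (mat 1) A *v x0 + toeplitz (mat 1) A B *v U)
      \<bullet> (obs_col (mat 1) A *v x0 + toeplitz (mat 1) A B *v U)"
proof -
  let ?x = "mean_state P A B w x0 (block_at U)"
  let ?z = "obs_col (mat 1) A *v x0 + toeplitz (mat 1) A B *v U :: real ^ ('t \<times> 'n)"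
  note dyn = mean_state_dynamics[OF assms]
  have z: "?z $ (t, i) = ?x (Suc (time_pos t)) $ i" for t i
    using stacked_recurrence[of ?x A B U t i, OF dyn(2)] by (simp add: dyn(1))
  have "?z \<bullet> ?z = (\<Sum>t\<in>UNIV. \<Sum>i\<in>UNIV. ?z $ (t, i) * ?z $ (t, i))"
    by (simp add: inner_vec_def sum.cartesian_product flip: UNIV_Times_UNIV)
  also have "\<dots> = (\<Sum>t\<in>UNIV. ?x (Suc (time_pos (t :: 't))) \<bullet> ?x (Suc (time_pos t)))"
    by (simp only: z) (simp add: inner_vec_def)
  also have "\<dots> = (\<Sum>k\<in>range (time_pos :: 't \<Rightarrow> nat). ?x (Suc k) \<bullet> ?x (Suc k))"
    by (simp add: sum.reindex inj_time_pos)
  also have "\<dots> = (\<Sum>k=1..CARD('t). ?x k \<bullet> ?x k)"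
    by (simp add: range_time_pos sum.atLeast1_atMost_eq)
  finally show ?thesis by (simp add: attack_objective_def)
qed

lemma attack_feasible_iff:
  assumes "prob_space P" and "\<And>k. centred_gaussian P (w k) S"
  shows "attack_feasible P A B w x0 M d U \<longleftrightarrow> ereal (U \<bullet> (M *v U)) \<le> d"
  by (simp add: attack_feasible_def mean_state_dynamics[OF assms])

section \<open>Symmetry of the detector gain\<close>

lemma transpose_kron: "transpose (kron K S) = kron (transpose K) (transpose S)"
  by (simp add: kron_def transpose_def vec_eq_iff)

lemma transpose_add: "transpose (X + Y) = transpose X + transpose Y"
  by (simp add: transpose_def vec_eq_iff)

lemma transpose_detector_cov:
  assumes "transpose Sw = Sw" "transpose Sv = Sv"
  shows "transpose (detector_cov N C A Sw Sv) = detector_cov N C A Sw Sv"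
  using assms by (simp add: detector_cov_def Let_def matrix_transpose_mul transpose_add
      transpose_kron transpose_mat matrix_mul_assoc)

lemma transpose_matrix_inv:
  fixes S :: "real ^ 'r ^ 'r"
  assumes "transpose S = S" "invertible S"
  shows "transpose (matrix_inv S) = matrix_inv S"
proof -
  have inv: "S ** matrix_inv S = mat 1" "matrix_inv S ** S = mat 1"
    using assms(2) unfolding invertible_def matrix_inv_def
    by (metis (mono_tags, lifting) someI_ex)+
  have "transpose (matrix_inv S) ** S = mat 1"
    by (metis assms(1) inv(1) matrix_transpose_mul transpose_mat)
  then show ?thesis
    by (metis inv(1) matrix_mul_assoc matrix_mul_lid matrix_mul_rid)
qed

lemma transpose_detector_gain:
  assumes "transpose Sw = Sw" "transpose Sv = Sv" "invertible (detector_cov N C A Sw Sv)"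
  shows "transpose (detector_gain N C A B Sw Sv) = detector_gain N C A B Sw Sv"
  using transpose_matrix_inv[OF transpose_detector_cov[OF assms(1,2)] assms(3)]
  by (simp add: detector_gain_def Let_def matrix_transpose_mul matrix_mul_assoc)


section \<open>Detection probability as a function of the noncentrality\<close>

text \<open>
  Both sides agree on boxes, where the integral of a product of functions of separate coordinates
  factorizes.
\<close>

lemma PiM_density:
  fixes f :: "'i \<Rightarrow> 'a \<Rightarrow> ennreal"
  assumes "finite I" and M: "\<And>i. sigma_finite_measure (M i)"
    and f[measurable]: "\<And>i. f i \<in> borel_measurable (M i)"
    and N: "\<And>i. sigma_finite_measure (density (M i) (f i))"
  shows "(\<Pi>\<^sub>M i\<in>I. density (M i) (f i)) = density (\<Pi>\<^sub>M i\<in>I. M i) (\<lambda>x. \<Prod>i\<in>I. f i (x i))"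
proof -
  interpret M: product_sigma_finite M by (simp add: product_sigma_finite_def M)
  interpret N: product_sigma_finite "\<lambda>i. density (M i) (f i)"
    by (simp add: product_sigma_finite_def N)
  show ?thesis
  proof (rule N.PiM_eqI[symmetric])
    show "finite I" by fact
    show "sets (density (Pi\<^sub>M I M) (\<lambda>x. \<Prod>i\<in>I. f i (x i))) = sets (\<Pi>\<^sub>M i\<in>I. density (M i) (f i))"
      by (simp cong: sets_PiM_cong)
    fix A assume "\<And>i. i \<in> I \<Longrightarrow> A i \<in> sets (density (M i) (f i))"
    then have A: "\<And>i. i \<in> I \<Longrightarrow> A i \<in> sets (M i)" by simp
    then have "Pi\<^sub>E I A \<in> sets (Pi\<^sub>M I M)" using \<open>finite I\<close> by (intro sets_PiM_I_finite)
    then have "emeasure (density (Pi\<^sub>M I M) (\<lambda>x. \<Prod>i\<in>I. f i (x i))) (Pi\<^sub>E I A)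
        = (\<integral>\<^sup>+x. (\<Prod>i\<in>I. f i (x i)) * indicator (Pi\<^sub>E I A) x \<partial>Pi\<^sub>M I M)"
      using \<open>finite I\<close> by (subst emeasure_density) auto
    also have "\<dots> = (\<integral>\<^sup>+x. (\<Prod>i\<in>I. f i (x i) * indicator (A i) (x i)) \<partial>Pi\<^sub>M I M)"
    proof (rule nn_integral_cong)
      fix x assume x: "x \<in> space (Pi\<^sub>M I M)"
      have "(indicator (Pi\<^sub>E I A) x :: ennreal) = (\<Prod>i\<in>I. indicator (A i) (x i))"
      proof (cases "x \<in> Pi\<^sub>E I A")
        case True then have "(\<Prod>i\<in>I. indicator (A i) (x i) :: ennreal) = 1"
          by (intro prod.neutral) (auto simp: PiE_iff)
        with True show ?thesis by simp
      next
        case False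
        with x obtain i where "i \<in> I" "x i \<notin> A i" by (auto simp: space_PiM PiE_iff)
        with \<open>finite I\<close> have "(\<Prod>i\<in>I. indicator (A i) (x i) :: ennreal) = 0"
          by (intro prod_zero bexI[of _ i]) auto
        with False show ?thesis by simp
      qed
      then show "(\<Prod>i\<in>I. f i (x i)) * indicator (Pi\<^sub>E I A) x = (\<Prod>i\<in>I. f i (x i) * indicator (A i) (x i))"
        by (simp add: prod.distrib)
    qed
    also have "\<dots> = (\<Prod>i\<in>I. \<integral>\<^sup>+y. f i y * indicator (A i) y \<partial>M i)"
      using A \<open>finite I\<close> by (intro M.product_nn_integral_prod) auto
    also have "\<dots> = (\<Prod>i\<in>I. emeasure (density (M i) (f i)) (A i))"
      using A by (intro prod.cong refl) (simp add: emeasure_density)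
    finally show "emeasure (density (Pi\<^sub>M I M) (\<lambda>x. \<Prod>i\<in>I. f i (x i))) (Pi\<^sub>E I A)
        = (\<Prod>i\<in>I. emeasure (density (M i) (f i)) (A i))" .
  qed
qed

definition std_gauss :: "real measure"
  where "std_gauss = density lborel (\<lambda>z. ennreal (normal_density 0 1 z))"

lemma sets_std_gauss[measurable_cong, simp]: "sets std_gauss = sets borel"
  by (simp add: std_gauss_def)

lemma prob_space_std_gauss: "prob_space std_gauss"
  by (simp add: std_gauss_def prob_space_normal_density)

lemma measurable_std_gauss_component:
  assumes "i \<in> I"
  shows "(\<lambda>z. z i) \<in> borel_measurable (\<Pi>\<^sub>M i\<in>I. std_gauss)"
  using measurable_component_singleton[OF assms, of "\<lambda>_. std_gauss"]
  by (simp add: measurable_cong_sets[OF refl sets_std_gauss])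

lemma measurable_sum_squares:
  "(\<lambda>z. \<Sum>i\<in>I. (z i)\<^sup>2) \<in> borel_measurable (\<Pi>\<^sub>M i\<in>I. std_gauss)"
  by (intro borel_measurable_sum borel_measurable_power measurable_std_gauss_component)

text \<open>
  Exponential tilting (Cameron--Martin): the mean enters through the integrand instead of the
  domain of integration.
\<close>

lemma normal_density_tilt:
  "density lborel (\<lambda>z. ennreal (normal_density \<mu> 1 z))
    = density std_gauss (\<lambda>z. ennreal (exp (\<mu> * z - \<mu>\<^sup>2 / 2)))"
proof -
  have "normal_density \<mu> 1 z = normal_density 0 1 z * exp (\<mu> * z - \<mu>\<^sup>2 / 2)" for z
    by (simp add: normal_density_def power2_diff diff_divide_distrib add_divide_distrib
        flip: exp_add)
  then show ?thesis
    unfolding std_gauss_def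
    by (subst density_density_eq) (simp_all add: ennreal_mult)
qed

text \<open>
  After tilting, the noncentrality occurs only in a continuous factor and the event \<open>\<Sum>i. z\<^sub>i\<^sup>2 \<le> \<tau>\<close> is
  fixed, so that no boundary of a moving ball has to be shown negligible.  The complementary event
  is used because the factor is bounded on it.  The noncentrality is written as \<open>\<mu>\<^sup>2\<close> so that the
  mean \<open>\<bar>\<mu>\<bar>\<close> of the shifted coordinate enters without a square root.
\<close>

lemma noncentral_chi_squared_ccdf:
  assumes "p > 0"
  shows "measure (noncentral_chi_squared p (\<mu>\<^sup>2)) {\<tau><..} =
    1 - (\<integral>z. exp (\<bar>\<mu>\<bar> * z 0 - \<mu>\<^sup>2 / 2) * indicator {z. (\<Sum>i<p. (z i)\<^sup>2) \<le> \<tau>} z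
          \<partial>(\<Pi>\<^sub>M i\<in>{..<p}. std_gauss))"
proof -
  let ?\<Gamma> = "\<Pi>\<^sub>M i\<in>{..<p}. std_gauss"
  let ?m = "\<lambda>i. if i = 0 then \<bar>\<mu>\<bar> else (0::real)"
  let ?q = "\<lambda>z::nat \<Rightarrow> real. \<Sum>i<p. (z i)\<^sup>2"
  let ?e = "\<lambda>z::nat \<Rightarrow> real. exp (\<bar>\<mu>\<bar> * z 0 - \<mu>\<^sup>2 / 2)"
  define N where "N = (\<Pi>\<^sub>M i\<in>{..<p}. density lborel (\<lambda>z. ennreal (normal_density (?m i) 1 z)))"
  have z0[measurable]: "(\<lambda>z. z 0) \<in> borel_measurable ?\<Gamma>"
    using assms by (simp add: measurable_std_gauss_component)
  have "N = (\<Pi>\<^sub>M i\<in>{..<p}. density std_gauss (\<lambda>z. ennreal (exp (?m i * z - (?m i)\<^sup>2 / 2))))"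
    unfolding N_def by (simp only: normal_density_tilt)
  also have "\<dots> = density ?\<Gamma> (\<lambda>x. \<Prod>i<p. ennreal (exp (?m i * x i - (?m i)\<^sup>2 / 2)))"
  proof (rule PiM_density)
    show "sigma_finite_measure (density std_gauss (\<lambda>z. ennreal (exp (?m i * z - (?m i)\<^sup>2 / 2))))" for i
      using prob_space_normal_density[of 1 "?m i"]
      by (simp only: normal_density_tilt prob_space_imp_sigma_finite zero_less_one)
    show "sigma_finite_measure std_gauss"
      by (simp add: prob_space_std_gauss prob_space_imp_sigma_finite)
    show "(\<lambda>z. ennreal (exp (?m i * z - (?m i)\<^sup>2 / 2))) \<in> borel_measurable std_gauss" for i
      unfolding measurable_cong_sets[OF sets_std_gauss refl] by measurable
  qed simp
  also have "(\<lambda>x. \<Prod>i<p. ennreal (exp (?m i * x i - (?m i)\<^sup>2 / 2))) = (\<lambda>x. ennreal (?e x))"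
  proof
    fix x :: "nat \<Rightarrow> real"
    have "(\<Prod>i<p. ennreal (exp (?m i * x i - (?m i)\<^sup>2 / 2)))
        = (\<Prod>i<p. if i = 0 then ennreal (?e x) else 1)"
      by (intro prod.cong) auto
    then show "(\<Prod>i<p. ennreal (exp (?m i * x i - (?m i)\<^sup>2 / 2))) = ennreal (?e x)"
      using assms by simp
  qed
  finally have N: "N = density ?\<Gamma> (\<lambda>x. ennreal (?e x))" .
  have setsN: "sets N = sets ?\<Gamma>" by (simp add: N)
  have spN: "space N = space ?\<Gamma>" by (simp add: N)
  have q[measurable]: "?q \<in> borel_measurable ?\<Gamma>"
    by (rule measurable_sum_squares)
  have e[measurable]: "?e \<in> borel_measurable ?\<Gamma>" using z0 by measurable
  have qN[measurable]: "?q \<in> borel_measurable N" using q by (simp add: measurable_cong_sets[OF setsN])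
  interpret N: prob_space N
    unfolding N_def by (intro prob_space_PiM prob_space_normal_density) simp
  have sqrt_m: "(if i = 0 then sqrt (\<mu>\<^sup>2) else 0) = ?m i" for i :: nat by simp
  have "measure (noncentral_chi_squared p (\<mu>\<^sup>2)) {\<tau><..} = measure (distr N borel ?q) {\<tau><..}"
    unfolding noncentral_chi_squared_def N_def sqrt_m ..
  also have "\<dots> = measure N {z \<in> space N. \<not> ?q z \<le> \<tau>}"
  proof (subst measure_distr[OF qN])
    have "?q -` {\<tau><..} \<inter> space N = {z \<in> space N. \<not> ?q z \<le> \<tau>}" by auto
    then show "measure N (?q -` {\<tau><..} \<inter> space N) = measure N {z \<in> space N. \<not> ?q z \<le> \<tau>}"
      by (rule arg_cong)
  qed simp
  also have "\<dots> = 1 - measure N {z \<in> space N. ?q z \<le> \<tau>}"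
    by (rule N.prob_neg) measurable
  also have "measure N {z \<in> space N. ?q z \<le> \<tau>} = (\<integral>z. indicator {z \<in> space N. ?q z \<le> \<tau>} z \<partial>N)"
    by simp
  also have "\<dots> = (\<integral>z. ?e z * indicator {z \<in> space N. ?q z \<le> \<tau>} z \<partial>?\<Gamma>)"
    unfolding spN unfolding N by (subst integral_density) auto
  also have "\<dots> = (\<integral>z. ?e z * indicator {z. ?q z \<le> \<tau>} z \<partial>?\<Gamma>)"
    unfolding spN by (intro Bochner_Integration.integral_cong) (auto simp: indicator_def)
  finally show ?thesis .
qed

text \<open>
  On the ball of radius \<open>sqrt \<tau>\<close> the tilting factor is at most \<open>exp (\<bar>\<mu>\<bar> sqrt \<tau> - \<mu>\<^sup>2 / 2)\<close>.  This
  is locally bounded in \<open>\<mu>\<close>, which gives continuity by dominated convergence, and it tends to 0.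
\<close>

lemma noncentral_chi_squared_ccdf_continuous_limit:
  assumes "p > 0" "\<tau> \<ge> 0"
  shows "continuous_on {0..} (\<lambda>\<mu>. measure (noncentral_chi_squared p (\<mu>\<^sup>2)) {\<tau><..})" (is ?cont)
    and "((\<lambda>\<mu>. measure (noncentral_chi_squared p (\<mu>\<^sup>2)) {\<tau><..}) \<longlongrightarrow> 1) at_top" (is ?lim)
proof -
  let ?\<Gamma> = "\<Pi>\<^sub>M i\<in>{..<p}. std_gauss"
  let ?S = "{z::nat \<Rightarrow> real. (\<Sum>i<p. (z i)\<^sup>2) \<le> \<tau>}"
  let ?h = "\<lambda>\<mu> z. exp (\<bar>\<mu>\<bar> * z 0 - \<mu>\<^sup>2 / 2) * indicator ?S z"
  interpret G: prob_space ?\<Gamma> by (intro prob_space_PiM prob_space_std_gauss)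
  have z0[measurable]: "(\<lambda>z. z 0) \<in> borel_measurable ?\<Gamma>"
    using assms by (simp add: measurable_std_gauss_component)
  have q[measurable]: "(\<lambda>z. \<Sum>i<p. (z i)\<^sup>2) \<in> borel_measurable ?\<Gamma>"
    by (rule measurable_sum_squares)
  have meas: "?h \<mu> \<in> borel_measurable ?\<Gamma>" for \<mu>
    unfolding indicator_def by measurable
  have bound: "?h \<mu> z \<le> exp (\<bar>\<mu>\<bar> * sqrt \<tau> - \<mu>\<^sup>2 / 2)" for \<mu> z
  proof (cases "z \<in> ?S")
    case True
    have "(z 0)\<^sup>2 \<le> (\<Sum>i<p. (z i)\<^sup>2)"
      using assms by (intro member_le_sum) auto
    with True have "z 0 \<le> sqrt \<tau>" by (intro real_le_rsqrt) simp
    with True show ?thesis by (simp add: mult_left_mono)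
  qed simp
  have dom: "norm (?h \<mu> z) \<le> exp (K * sqrt \<tau>)" if "\<bar>\<mu>\<bar> \<le> K" for \<mu> z K
  proof -
    have "\<bar>\<mu>\<bar> * sqrt \<tau> - \<mu>\<^sup>2 / 2 \<le> K * sqrt \<tau>"
      using mult_right_mono[OF that, of "sqrt \<tau>"] assms by (smt (verit) real_sqrt_ge_zero zero_le_divide_iff zero_le_power2)
    then have "exp (\<bar>\<mu>\<bar> * sqrt \<tau> - \<mu>\<^sup>2 / 2) \<le> exp (K * sqrt \<tau>)" by simp
    with bound have "?h \<mu> z \<le> exp (K * sqrt \<tau>)" by (rule order_trans)
    moreover have "0 \<le> ?h \<mu> z" by simp
    ultimately show ?thesis unfolding real_norm_def by (rule abs_of_nonneg[THEN ord_eq_le_trans, rotated])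
  qed
  have int: "integrable ?\<Gamma> (?h \<mu>)" for \<mu>
  proof (rule G.integrable_const_bound[OF _ meas])
    show "AE z in ?\<Gamma>. norm (?h \<mu> z) \<le> exp (\<bar>\<mu>\<bar> * sqrt \<tau>)"
      by (intro AE_I2 dom) simp
  qed
  note eq = noncentral_chi_squared_ccdf[OF assms(1)]
  have "isCont (\<lambda>\<mu>. \<integral>z. ?h \<mu> z \<partial>?\<Gamma>) \<mu>" for \<mu>
    unfolding isCont_def tendsto_at_iff_sequentially comp_def
  proof (intro allI impI)
    fix X :: "nat \<Rightarrow> real" assume "\<forall>i. X i \<in> UNIV - {\<mu>}" and X: "X \<longlonglongrightarrow> \<mu>"
    have "eventually (\<lambda>n. \<bar>X n\<bar> \<le> \<bar>\<mu>\<bar> + 1) sequentially"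
      using tendstoD[OF X, of 1] by (auto elim!: eventually_mono simp: dist_real_def)
    then obtain n0 where "\<And>n. n \<ge> n0 \<Longrightarrow> \<bar>X n\<bar> \<le> \<bar>\<mu>\<bar> + 1"
      unfolding eventually_sequentially by blast
    then have n0: "\<bar>X (n + n0)\<bar> \<le> \<bar>\<mu>\<bar> + 1" for n by simp
    have "(\<lambda>n. \<integral>z. ?h (X (n + n0)) z \<partial>?\<Gamma>) \<longlonglongrightarrow> (\<integral>z. ?h \<mu> z \<partial>?\<Gamma>)"
    proof (rule integral_dominated_convergence[where w = "\<lambda>_. exp ((\<bar>\<mu>\<bar> + 1) * sqrt \<tau>)"])
      show "AE z in ?\<Gamma>. (\<lambda>n. ?h (X (n + n0)) z) \<longlonglongrightarrow> ?h \<mu> z"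
        using LIMSEQ_ignore_initial_segment[OF X, of n0] by (intro AE_I2 tendsto_intros) auto
      show "AE z in ?\<Gamma>. norm (?h (X (n + n0)) z) \<le> exp ((\<bar>\<mu>\<bar> + 1) * sqrt \<tau>)" for n
        using dom[OF n0] by (intro AE_I2)
    qed (use meas in auto)
    then show "(\<lambda>n. \<integral>z. ?h (X n) z \<partial>?\<Gamma>) \<longlonglongrightarrow> (\<integral>z. ?h \<mu> z \<partial>?\<Gamma>)"
      by (rule LIMSEQ_offset)
  qed
  then show ?cont
    unfolding eq by (intro continuous_on_diff continuous_on_const continuous_at_imp_continuous_on) auto
  have "((\<lambda>\<mu>. \<integral>z. ?h \<mu> z \<partial>?\<Gamma>) \<longlongrightarrow> 0) at_top"
  proof (rule tendsto_sandwich)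
    show "\<forall>\<^sub>F \<mu> in at_top. 0 \<le> (\<integral>z. ?h \<mu> z \<partial>?\<Gamma>)"
      by (intro always_eventually allI integral_nonneg_AE) auto
    show "\<forall>\<^sub>F \<mu> in at_top. (\<integral>z. ?h \<mu> z \<partial>?\<Gamma>) \<le> exp (\<bar>\<mu>\<bar> * sqrt \<tau> - \<mu>\<^sup>2 / 2)"
      using int bound by (intro always_eventually allI G.integral_le_const) auto
    show "((\<lambda>\<mu>. exp (\<bar>\<mu>\<bar> * sqrt \<tau> - \<mu>\<^sup>2 / 2)) \<longlongrightarrow> 0) at_top"
      by real_asymp
  qed simp
  from tendsto_diff[OF tendsto_const this] show ?lim unfolding eq by simp
qed

text \<open>
  The inverse is a choice function, so its value is informative only for levels that are attained.
  The intermediate value theorem supplies this, and the noncentrality 0 is excluded since it yields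
  a smaller level.
\<close>

lemma chi_ccdf_inv_pos:
  assumes "p > 0" "\<tau> \<ge> 0" "chi_ccdf \<tau> p 0 < \<delta>" "\<delta> \<le> 1"
  shows "chi_ccdf_inv \<tau> p \<delta> > 0"
proof -
  let ?F = "\<lambda>\<mu>::real. measure (noncentral_chi_squared p (\<mu>\<^sup>2)) {\<tau><..}"
  have F: "chi_ccdf \<tau> p (ereal (\<mu>\<^sup>2)) = ?F \<mu>" for \<mu> by (simp add: chi_ccdf_def)
  have "\<delta> \<in> chi_ccdf \<tau> p ` {0..}"
  \<comment> \<open>The level 1 may be reached at infinite noncentrality only.\<close>
  proof (cases "\<delta> = 1")
    case True
    then show ?thesis by (intro image_eqI[of _ _ \<infinity>]) (simp_all add: chi_ccdf_def)
  next
    case False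
    with assms have "eventually (\<lambda>\<mu>. \<delta> < ?F \<mu> \<and> \<mu> \<ge> 0) at_top"
      by (intro eventually_conj eventually_ge_at_top
          order_tendstoD(1)[OF noncentral_chi_squared_ccdf_continuous_limit(2)]) auto
    then obtain K where K: "\<delta> < ?F K" "K \<ge> 0"
      by (metis (no_types, lifting) eventually_happens trivial_limit_at_top_linorder)
    have "?F 0 \<le> \<delta>" using assms(3) F[of 0] by (simp add: zero_ereal_def)
    moreover have "continuous_on {0..K} ?F"
      using noncentral_chi_squared_ccdf_continuous_limit(1)[OF assms(1,2)]
      by (rule continuous_on_subset) auto
    ultimately obtain \<mu> where "\<mu> \<ge> 0" "?F \<mu> = \<delta>"
      using IVT'[of ?F 0 \<delta> K] K by auto
    then show ?thesis using F[of \<mu>] by (intro image_eqI[of _ _ "ereal (\<mu>\<^sup>2)"]) auto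
  qed
  then have "chi_ccdf_inv \<tau> p \<delta> \<in> {0..}" "chi_ccdf \<tau> p (chi_ccdf_inv \<tau> p \<delta>) = \<delta>"
    unfolding chi_ccdf_inv_def by (rule inv_into_into, rule f_inv_into_f)
  with assms(3) show ?thesis by (metis atLeast_iff less_irrefl order_le_less)
qed


section \<open>Optimality equations of the attack\<close>

theorem theoremV1:
  fixes P :: "'w measure"
    and A Sw :: "real ^ 'n ^ 'n"
    and B :: "real ^ 'm ^ 'n"
    and C :: "real ^ 'n ^ 'p"
    and Sv :: "real ^ 'p ^ 'p"
    and w :: "nat \<Rightarrow> 'w \<Rightarrow> real ^ 'n"
    and v :: "nat \<Rightarrow> 'w \<Rightarrow> real ^ 'p"
    and x0 :: "real ^ 'n"
    and sx :: "'n \<Rightarrow> 's::finite" and su :: "'m \<Rightarrow> 's" and sy :: "'p \<Rightarrow> 's"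
    and Nc :: "real ^ ('t::{finite,linorder} \<times> 'p) ^ 'r"
    and \<Sigma> :: "real ^ 'r ^ 'r"
    and M :: "real ^ ('t \<times> 'm) ^ ('t \<times> 'm)"
    and \<A> :: "real ^ 'n ^ ('t \<times> 'n)"
    and \<B> :: "real ^ ('t \<times> 'm) ^ ('t \<times> 'n)"
    and \<tau> PF \<delta> :: real
    and dtil :: ereal
    and U :: "real ^ ('t \<times> 'm)"
  assumes "noise_model P w v Sw Sv"
    and "block_diagonal sx su B" "block_diagonal sy sx C"
    and "block_diagonal sx sx Sw" "block_diagonal sy sy Sv"
    and "B \<noteq> 0"
    and "left_null_basis Nc (obs_col C A)"
    and "\<Sigma> = detector_cov Nc C A Sw Sv" "invertible \<Sigma>"
    and "M = detector_gain Nc C A B Sw Sv"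
    and "\<tau> \<ge> 0" "PF = chi_ccdf \<tau> (rank \<Sigma>) 0"
    and "PF < \<delta>" "\<delta> \<le> 1"
    and "dtil = chi_ccdf_inv \<tau> (rank \<Sigma>) \<delta>"
    and "\<A> = obs_col (mat 1) A" "\<B> = toeplitz (mat 1) A B"
    and "attack_solution P A B w x0 M dtil U"
  shows "\<exists>\<gamma>>0. (transpose \<B> ** \<B> - \<gamma> *\<^sub>R M) *v U + (transpose \<B> ** \<A>) *v x0 = 0
    \<and> ereal (U \<bullet> (M *v U)) = dtil"
proof -
  have P: "prob_space P" and w: "\<And>k. centred_gaussian P (w k) Sw"
    and v: "\<And>k. centred_gaussian P (v k) Sv"
    using assms(1) by (simp_all add: noise_model_def)
  have Sw: "transpose Sw = Sw" and Sv: "transpose Sv = Sv"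
    using w[of 0] v[of 0] by (simp_all add: centred_gaussian_def covariance_matrix_def)
  have M: "transpose M = M"
    unfolding \<open>M = _\<close> using \<open>invertible \<Sigma>\<close> unfolding \<open>\<Sigma> = _\<close>
    by (rule transpose_detector_gain[OF Sw Sv])
  have \<B>: "\<B> \<noteq> 0"
    unfolding \<open>\<B> = _\<close> by (rule toeplitz_nonzero) fact
  have "rank \<Sigma> = CARD('r)"
    using inj_matrix_vector_mult[OF \<open>invertible \<Sigma>\<close>] by (simp add: full_rank_injective)
  then have "rank \<Sigma> > 0" by simp
  then have dtil_pos: "dtil > 0"
    unfolding \<open>dtil = _\<close> using \<open>PF < \<delta>\<close> unfolding \<open>PF = _\<close>
    by (intro chi_ccdf_inv_pos assms)
  let ?z = "\<lambda>V. \<A> *v x0 + \<B> *v V"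
  have feas: "ereal (U \<bullet> (M *v U)) \<le> dtil"
    and opt: "\<And>V. ereal (V \<bullet> (M *v V)) \<le> dtil \<Longrightarrow> ?z V \<bullet> ?z V \<le> ?z U \<bullet> ?z U"
    using \<open>attack_solution P A B w x0 M dtil U\<close> \<open>\<A> = _\<close> \<open>\<B> = _\<close>
    by (auto simp: attack_solution_def is_arg_max_linorder attack_feasible_iff[OF P w]
        attack_objective_eq[OF P w])
  have "dtil \<noteq> \<infinity>"
  proof
    assume "dtil = \<infinity>"
    \<comment> \<open>Every attack is feasible, so full steps are admissible in all directions.\<close>
    then have "\<B> = 0"
      by (intro not_directional_max[of "\<A> *v x0" \<B> U] exI[of _ 1] conjI opt) simp_all
    with \<B> show False ..
  qed
  with dtil_pos obtain d where d: "dtil = ereal d" "d > 0" by (cases dtil) auto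
  note kkt = constrained_max_multiplier[of M \<B> d U "\<A> *v x0", OF M \<B> \<open>d > 0\<close>]
  have active: "U \<bullet> (M *v U) = d"
    using feas opt by (intro kkt(1)) (simp_all add: d)
  obtain \<gamma> where "\<gamma> > 0" and \<gamma>: "transpose \<B> *v ?z U = \<gamma> *\<^sub>R (M *v U)"
    using kkt(2) feas opt by (auto simp: d)
  have "(transpose \<B> ** \<B> - \<gamma> *\<^sub>R M) *v U + (transpose \<B> ** \<A>) *v x0
      = transpose \<B> *v ?z U - \<gamma> *\<^sub>R (M *v U)"
    by (simp add: matrix_vector_mult_diff_rdistrib matrix_vector_right_distrib
        scaleR_matrix_vector_assoc flip: matrix_vector_mul_assoc)
  with \<gamma> \<open>\<gamma> > 0\<close> active show ?thesis by (auto simp: d)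
qed

end
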